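(* Let $n\ge1$, $0\le k\le n$, and $t\in\mathbb{C}^\times$. Let $\sigma_t\in\mathrm{GL}_n(\mathbb{C})$ be $\sigma_t(v_1,\dots,v_n)=(v_2,v_3,\dots,v_n,(-1)^{k-1}t\,v_1)$, acting on $\mathrm{Gr}_{k,n}(\mathbb{C})$ by $V\mapsto\{\sigma_t(v):v\in V\}$. For a $k$-subset $S\subseteq\mathbb{C}$ let $V_S$ be the span of $\{(1,z,\dots,z^{n-1}):z\in S\}$, and let $S_0=\{e^{i(k-1-2j)\pi/n}:0\le j\le k-1\}$. Then $\sigma_t$ has exactly $\binom nk$ fixed points in $\mathrm{Gr}_{k,n}(\mathbb{C})$, namely $V_S$ for the $k$-subsets $S$ of the set of $n$th roots of $(-1)^{k-1}t$. Moreover, such a $V_S$ is totally nonnegative if and only if $t$ is a positive real number and $S=t^{1/n}S_0$ (with $t^{1/n}>0$ the positive real $n$th root), in which case, up to a common nonzero scalar, $$\Delta_I(V_S)=t^{(i_1+\cdots+i_k)/n}\prod_{1\le r<s\le k}\sin\!\Big(\frac{i_s-i_r}{n}\pi\Big)\quad\text{for all }I=\{i_1<\cdots<i_k\}\subseteq\{1,\dots,n\}.$$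
   Context: $\mathrm{Gr}_{k,n}(\mathbb{C})$ is the set of $k$-dimensional subspaces of $\mathbb{C}^n$. For $V$ the row span of a $k\times n$ matrix $A$ and a $k$-subset $I$, $\Delta_I(V)$ is the $k\times k$ minor of $A$ in columns $I$ (well defined up to a common nonzero scalar). $V$ is totally nonnegative if for some choice of this scalar $\Delta_I(V)\ge 0$ for all $I$.
   Formalization: The equivalence for total nonnegativity is stated only when 0<k<n or t is a positive real; for k=0 or k=n with t not positive it is false, since the only point of the Grassmannian is then totally nonnegative for every t. *)

theory Defs
  imports
    Complex_Main
    "HOL-Library.Nonpos_Ints"
    "Jordan_Normal_Form.VS_Connect"
    "Jordan_Normal_Form.DL_Submatrix"
begin

abbreviation cvec_module :: "nat \<Rightarrow> (complex, complex vec) module" where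
  "cvec_module n \<equiv> module_vec TYPE(complex) n"

definition Gr :: "nat \<Rightarrow> nat \<Rightarrow> complex vec set set" where
  "Gr k n = {V. VectorSpace.subspace class_ring V (cvec_module n) \<and>
    vectorspace.dim class_ring ((cvec_module n)\<lparr>carrier := V\<rparr>) = k}"

text \<open>Columns of a matrix are numbered from 1 here, while the matrix library numbers
  them from 0.\<close>

definition maximal_minor :: "complex mat \<Rightarrow> nat set \<Rightarrow> complex" where
  "maximal_minor A I = det (submatrix A UNIV {j. Suc j \<in> I})"

definition k_subsets :: "nat \<Rightarrow> nat \<Rightarrow> nat set set" where
  "k_subsets k n = {I. I \<subseteq> {1..n} \<and> card I = k}"

text \<open>Plucker coordinates are defined only up to a common nonzero scalar, so they are
  given by a relation: \<open>p\<close> (restricted to \<open>k_subsets k n\<close>) is one admissible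
  choice of the family \<open>\<Delta>\<^sub>I(V)\<close>.\<close>

definition plucker_coords ::
    "nat \<Rightarrow> nat \<Rightarrow> complex vec set \<Rightarrow> (nat set \<Rightarrow> complex) \<Rightarrow> bool" where
  "plucker_coords k n V p \<longleftrightarrow> V \<in> Gr k n \<and>
    (\<exists>A \<in> carrier_mat k n. \<exists>c. vec_space.row_space n A = V \<and> c \<noteq> 0 \<and>
      (\<forall>I \<in> k_subsets k n. p I = c * maximal_minor A I))"

text \<open>For \<open>k = 0\<close> and \<open>k = n\<close> there is a single Plucker coordinate, which can be
  scaled to 1, so the unique element of \<open>Gr k n\<close> is totally nonnegative and, being
  fixed by every \<open>\<sigma>\<^sub>t\<close>, says nothing about \<open>t\<close>.\<close>

definition totally_nonneg :: "nat \<Rightarrow> nat \<Rightarrow> complex vec set \<Rightarrow> bool" where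
  "totally_nonneg k n V \<longleftrightarrow>
    (\<exists>p. plucker_coords k n V p \<and> (\<forall>I \<in> k_subsets k n. p I \<in> \<real>\<^sub>\<ge>\<^sub>0))"

text \<open>The exponent \<open>k - 1\<close> is taken in the integers, so that it is \<open>-1\<close> for
  \<open>k = 0\<close>.\<close>

definition twist :: "nat \<Rightarrow> complex \<Rightarrow> complex" where
  "twist k t = (-1) powi (int k - 1) * t"

definition \<sigma> :: "nat \<Rightarrow> nat \<Rightarrow> complex \<Rightarrow> complex vec \<Rightarrow> complex vec" where
  "\<sigma> k n t v = vec n (\<lambda>i. if Suc i < n then v $ Suc i else twist k t * v $ 0)"

definition V_span :: "nat \<Rightarrow> complex set \<Rightarrow> complex vec set" where
  "V_span n S = LinearCombinations.module.span class_ring (cvec_module n)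
    ((\<lambda>z. vec n (\<lambda>i. z ^ i)) ` S)"

definition S\<^sub>0 :: "nat \<Rightarrow> nat \<Rightarrow> complex set" where
  "S\<^sub>0 k n = (\<lambda>j. exp (\<i> * of_real ((real k - 1 - 2 * real j) * pi / real n))) ` {j. j < k}"

definition root_subsets :: "nat \<Rightarrow> nat \<Rightarrow> complex \<Rightarrow> complex set set" where
  "root_subsets k n t = {S. S \<subseteq> {z. z ^ n = twist k t} \<and> card S = k}"

definition pos_real :: "complex \<Rightarrow> bool" where
  "pos_real t \<longleftrightarrow> t \<in> \<real> \<and> Re t > 0"

end

theory Submission
  imports
    Defs
    "HOL-Computational_Algebra.Polynomial"
begin

text \<open>Write \<open>v\<^sub>z = (1, z, \<dots>, z^(n-1))\<close>. For \<open>z\<close> an \<open>n\<close>th root of \<open>(-1)^(k-1) t\<close> this is an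
  eigenvector of \<open>\<sigma>\<^sub>t\<close> with eigenvalue \<open>z\<close>, and there are \<open>n\<close> distinct such eigenvalues, so the
  invariant subspaces are the \<open>V\<^sub>S\<close>.

  Let \<open>t > 0\<close> and \<open>r = t^(1/n)\<close>. The minors of the matrix with rows \<open>v\<^sub>z\<close>, \<open>z \<in> r S\<^sub>0\<close>, are, after
  scaling columns, Vandermonde determinants in the numbers \<open>exp (-2\<pi>ic/n)\<close>, with \<open>c\<close> running
  through the columns; this gives the product of sines.

  Let \<open>V\<^sub>S\<close> be totally nonnegative. If \<open>0 < k < n\<close>, then with \<open>\<mu> = \<Prod>S\<close> and \<open>\<Delta>\<^sub>I\<close> the minors of the
  matrix with rows \<open>v\<^sub>z\<close>, \<open>z \<in> S\<close>, the second of the column sets \<open>{1..k}\<close>, \<open>{2..k+1}\<close> and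
  \<open>{1..k-1, n}\<close> has \<open>\<mu>\<close> times the minor of the first, and the third has \<open>t / \<mu>\<close> times that
  minor. As the first is a nonzero Vandermonde determinant, \<open>\<mu> > 0\<close> and \<open>t > 0\<close>. If \<open>t > 0\<close> but
  \<open>S \<noteq> r S\<^sub>0\<close>, choose \<open>z \<in> S\<close> outside \<open>r S\<^sub>0\<close>. Then \<open>v\<^sub>z\<close> is orthogonal to \<open>v\<^sub>w\<close> for every
  inverse \<open>w\<close> of an element of \<open>r S\<^sub>0\<close>. So if \<open>\<Delta>'\<^sub>I\<close> are the minors for these \<open>w\<close>, the sum of
  \<open>\<Delta>\<^sub>I \<Delta>'\<^sub>I\<close> over all \<open>I\<close> vanishes by Cauchy--Binet. But up to common scalars \<open>\<Delta>'\<^sub>I > 0\<close> by the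
  sine formula for \<open>1/t\<close>, and \<open>\<Delta>\<^sub>I \<ge> 0\<close> is not identically zero.\<close>

section \<open>Determinants of selected columns\<close>

text \<open>The column choice \<open>f\<close> is an arbitrary map, not necessarily increasing or
  injective, so that Cauchy--Binet can sum over all maps. Entries are given by a function, so a
  column beyond the width of a matrix still makes sense.\<close>

definition col_det :: "nat \<Rightarrow> (nat \<Rightarrow> nat \<Rightarrow> complex) \<Rightarrow> (nat \<Rightarrow> nat) \<Rightarrow> complex" where
  "col_det k F f = det (mat k k (\<lambda>(a, b). F a (f b)))"

lemma col_det_cong:
  "(\<And>a b. a < k \<Longrightarrow> b < k \<Longrightarrow> F a (f b) = G a (g b)) \<Longrightarrow> col_det k F f = col_det k G g"
  unfolding col_det_def by (rule arg_cong[where f = det]) (auto intro!: cong_mat)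

lemma col_det_leibniz:
  "col_det k F f = (\<Sum>p | p permutes {0..<k}. signof p * (\<Prod>b<k. F (p b) (f b)))"
proof -
  have "(\<Prod>b<k. mat k k (\<lambda>(a, b). F a (f b)) $$ (p b, b)) = (\<Prod>b<k. F (p b) (f b))"
    if "p permutes {0..<k}" for p
    using that
    by (intro prod.cong refl) (auto dest: permutes_in_image[THEN iffD2])
  then show ?thesis
    unfolding col_det_def by (subst det_col[of _ k]) auto
qed

lemma col_det_scale_cols:
  "col_det k (\<lambda>a c. g c * F a c) f = (\<Prod>b<k. g (f b)) * col_det k F f"
  unfolding col_det_leibniz by (simp add: prod.distrib sum_distrib_left ac_simps)

lemma col_det_scale_rows:
  "col_det k (\<lambda>a c. g a * F a c) f = (\<Prod>a<k. g a) * col_det k F f"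
proof -
  have "(\<Prod>b<k. g (p b)) = (\<Prod>b<k. g b)" if "p permutes {0..<k}" for p
    using prod.permute[OF that, of g] by (simp add: o_def atLeast0LessThan)
  then show ?thesis
    unfolding col_det_leibniz sum_distrib_left
    by (intro sum.cong refl) (simp add: prod.distrib)
qed

text \<open>Puts the selection on rows, where \<open>det_permute_rows\<close> and
  \<open>det_identical_rows\<close> apply.\<close>

lemma col_det_transpose: "col_det k F f = det (mat k k (\<lambda>(a, b). F b (f a)))"
  unfolding col_det_def
  by (subst det_transpose[symmetric, of _ k]) (auto intro!: arg_cong[where f = det] eq_matI)

lemma col_det_permute:
  assumes "p permutes {..<k}"
  shows "col_det k F (\<lambda>b. f (p b)) = signof p * col_det k F f"
proof -
  let ?A = "mat k k (\<lambda>(a, b). F b (f a))"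
  have p: "p permutes {0..<k}" using assms by (simp add: atLeast0LessThan)
  have "p b < k" if "b < k" for b using permutes_in_image[OF assms] that by auto
  then have "mat k k (\<lambda>(a, b). ?A $$ (p a, b)) = mat k k (\<lambda>(a, b). F b (f (p a)))"
    by (auto intro!: eq_matI)
  then show ?thesis
    using det_permute_rows[OF _ p, of ?A] by (simp add: col_det_transpose)
qed

lemma col_det_not_inj:
  assumes "\<not> inj_on f {..<k}"
  shows "col_det k F f = 0"
proof -
  obtain a b where ab: "a < k" "b < k" "a \<noteq> b" "f a = f b"
    using assms by (auto simp: inj_on_def)
  show ?thesis unfolding col_det_transpose
    by (rule det_identical_rows[OF _ ab(3,1,2)]) (use ab in \<open>auto intro!: eq_vecI\<close>)
qed

text \<open>Cauchy--Binet, with the sum taken over all maps \<open>f\<close> instead of all column sets: every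
  product of corresponding maximal minors then occurs \<open>k!\<close> times, as both factors change by the
  same sign when columns are permuted, and the sum factors without any regrouping.\<close>

lemma col_det_orthogonal:
  assumes "i < k" and "\<And>j. j < k \<Longrightarrow> (\<Sum>c<n. F i c * G j c) = 0"
  shows "(\<Sum>f \<in> {..<k} \<rightarrow>\<^sub>E {..<n}. col_det k F f * col_det k G f) = 0"
proof -
  let ?P = "{p. p permutes {0..<k}}" and ?E = "{..<k} \<rightarrow>\<^sub>E {..<n}"
  have "(\<Sum>f\<in>?E. col_det k F f * col_det k G f) =
     (\<Sum>f\<in>?E. \<Sum>p\<in>?P. \<Sum>q\<in>?P. signof p * signof q * (\<Prod>b<k. F (p b) (f b) * G (q b) (f b)))"
    unfolding col_det_leibniz by (simp add: sum_product prod.distrib ac_simps)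
  also have "\<dots> = (\<Sum>p\<in>?P. \<Sum>q\<in>?P. \<Sum>f\<in>?E. signof p * signof q * (\<Prod>b<k. F (p b) (f b) * G (q b) (f b)))"
    by (subst sum.swap, rule sum.cong[OF refl], rule sum.swap)
  also have "\<dots> = (\<Sum>p\<in>?P. \<Sum>q\<in>?P. signof p * signof q * (\<Prod>b<k. \<Sum>c<n. F (p b) c * G (q b) c))"
    by (simp add: prod_sum_PiE flip: sum_distrib_left)
  also have "\<dots> = 0"
  proof (intro sum.neutral ballI)
    fix p q assume "p \<in> ?P" "q \<in> ?P"
    then have pq: "p permutes {0..<k}" "q permutes {0..<k}" by auto
    \<comment> \<open>Row \<open>i\<close> of \<open>F\<close> is orthogonal to every row of
      \<open>G\<close>, so the factor at this \<open>b\<close> vanishes, whichever row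
      \<open>q b\<close> is.\<close>
    obtain b where b: "b < k" "p b = i"
      using permutes_image[OF pq(1)] assms(1) by (metis atLeastLessThan_iff imageE le0)
    have "q b < k" using permutes_in_image[OF pq(2), of b] b by auto
    then have "(\<Sum>c<n. F (p b) c * G (q b) c) = 0" using assms(2) b by simp
    then have "(\<Prod>b<k. \<Sum>c<n. F (p b) c * G (q b) c) = 0" using b by (intro prod_zero) auto
    then show "signof p * signof q * (\<Prod>b<k. \<Sum>c<n. F (p b) c * G (q b) c) = 0" by simp
  qed
  finally show ?thesis .
qed

text \<open>Replacing the monomials by the monic polynomials \<open>q i\<close> with roots
  \<open>y 0, ..., y (i - 1)\<close> is multiplication by the unitriangular \<open>?L\<close>. Their
  values at the \<open>y b\<close> form an upper triangular matrix whose diagonal gives the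
  product.\<close>

lemma vandermonde_det:
  fixes y :: "nat \<Rightarrow> 'a :: idom"
  shows "det (mat k k (\<lambda>(a, b). y b ^ a)) = (\<Prod>b<k. \<Prod>l<b. y b - y l)"
proof -
  define q where "q i = (\<Prod>l<i. [:- y l, 1:])" for i
  have deg: "degree (q i) = i" for i
    unfolding q_def by (subst degree_prod_eq_sum_degree) auto
  have monic: "coeff (q i) i = 1" for i
  proof -
    have "lead_coeff (q i) = 1" unfolding q_def lead_coeff_prod by simp
    then show ?thesis by (simp add: deg)
  qed
  let ?V = "mat k k (\<lambda>(a, b). y b ^ a)"
  let ?L = "mat k k (\<lambda>(a, b). coeff (q a) b)"
  let ?U = "mat k k (\<lambda>(a, b). poly (q a) (y b))"
  have "det ?L = prod_list (diag_mat ?L)"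
    by (rule det_lower_triangular[of k]) (auto simp: deg intro: coeff_eq_0)
  also have "\<dots> = 1" 
    by (simp add: diag_mat_def prod.list_conv_set_nth monic)
  finally have L: "det ?L = 1" .
  have "?L * ?V = ?U"
  proof (rule eq_matI)
    fix i j assume "i < dim_row ?U" "j < dim_col ?U"
    then have ij: "i < k" "j < k" by auto
    have "(?L * ?V) $$ (i, j) = (\<Sum>m<k. coeff (q i) m * y j ^ m)"
      using ij by (simp add: scalar_prod_def atLeast0LessThan)
    also have "\<dots> = (\<Sum>m\<le>degree (q i). coeff (q i) m * y j ^ m)"
      using ij by (intro sum.mono_neutral_right) (auto simp: deg intro: coeff_eq_0)
    finally show "(?L * ?V) $$ (i, j) = ?U $$ (i, j)" using ij by (simp add: poly_altdef)
  qed auto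
  then have "det ?L * det ?V = det ?U"
    using det_mult[of ?L k ?V] by simp
  also have "det ?U = prod_list (diag_mat ?U)"
    by (rule det_upper_triangular[of _ k]) (auto simp: q_def poly_prod upper_triangular_def intro!: prod_zero)
  also have "\<dots> = (\<Prod>b<k. \<Prod>l<b. y b - y l)"
    by (simp add: diag_mat_def q_def poly_prod prod.list_conv_set_nth atLeast0LessThan)
  finally show ?thesis using L by simp
qed

section \<open>Maximal minors\<close>

text \<open>Exactly \<open>b\<close> elements of the image lie below \<open>f b\<close>, and this
  rank determines \<open>pick\<close>.\<close>

lemma pick_image_strict_mono:
  assumes f: "strict_mono_on {..<k} f" and b: "b < k"
  shows "pick (f ` {..<k}) b = f b"
proof -
  have "{c \<in> f ` {..<k}. c < f b} = f ` {..<b}"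
    using b strict_mono_on_less[OF f] by (auto intro: less_trans)
  moreover have "inj_on f {..<b}"
    using strict_mono_on_imp_inj_on[OF f] b by (auto intro: inj_on_subset)
  ultimately have "card {c \<in> f ` {..<k}. c < f b} = b"
    by (simp add: card_image)
  then show ?thesis using pick_card_in_set[of "f b" "f ` {..<k}"] b by simp
qed

lemma strict_mono_on_pick: "finite I \<Longrightarrow> strict_mono_on {..<card I} (pick I)"
  by (auto intro!: strict_mono_onI intro: pick_mono_le)

lemma pick_image: "pick I ` {..<card I} = I" if "finite I"
proof (rule card_subset_eq[OF that])
  show "pick I ` {..<card I} \<subseteq> I" by (auto simp: pick_in_set_le)
  show "card (pick I ` {..<card I}) = card I"
    using strict_mono_on_imp_inj_on[OF strict_mono_on_pick[OF that]] by (simp add: card_image)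
qed

text \<open>Trades column sets for increasing maps. The \<open>Suc\<close> reconciles columns
  numbered from 1 with exponents numbered from 0.\<close>

lemma k_subsets_iff:
  "I \<in> k_subsets k n \<longleftrightarrow>
    (\<exists>f. strict_mono_on {..<k} f \<and> f ` {..<k} \<subseteq> {..<n} \<and> I = (\<lambda>b. Suc (f b)) ` {..<k})"
proof
  assume I: "I \<in> k_subsets k n"
  let ?J = "{j. Suc j \<in> I}"
  have sub: "?J \<subseteq> {..<n}" and IJ: "I = Suc ` ?J"
    using I by (auto simp: k_subsets_def image_iff) (metis Suc_le_D atLeastAtMost_iff subsetD)
  have fin: "finite ?J" using sub finite_subset by blast
  have card: "card ?J = k"
    using I IJ card_image[of Suc ?J] by (auto simp: k_subsets_def)
  show "\<exists>f. strict_mono_on {..<k} f \<and> f ` {..<k} \<subseteq> {..<n} \<and> I = (\<lambda>b. Suc (f b)) ` {..<k}"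
    using strict_mono_on_pick[OF fin] pick_image[OF fin] sub IJ
    by (intro exI[of _ "pick ?J"]) (simp add: card image_image[of Suc "pick ?J", symmetric])
next
  assume "\<exists>f. strict_mono_on {..<k} f \<and> f ` {..<k} \<subseteq> {..<n} \<and> I = (\<lambda>b. Suc (f b)) ` {..<k}"
  then obtain f where f: "strict_mono_on {..<k} f" "f ` {..<k} \<subseteq> {..<n}"
    "I = (\<lambda>b. Suc (f b)) ` {..<k}" by blast
  have "inj_on (\<lambda>b. Suc (f b)) {..<k}"
    using strict_mono_on_imp_inj_on[OF f(1)] by (auto simp: inj_on_def)
  then show "I \<in> k_subsets k n"
    using f(2,3) by (auto simp: k_subsets_def card_image)
qed

lemma maximal_minor_eq_col_det:
  assumes A: "A \<in> carrier_mat k n"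
    and f: "strict_mono_on {..<k} f" "f ` {..<k} \<subseteq> {..<n}"
  shows "maximal_minor A ((\<lambda>b. Suc (f b)) ` {..<k}) = col_det k (\<lambda>a c. A $$ (a, c)) f"
proof -
  let ?J = "f ` {..<k}"
  have J: "{j. Suc j \<in> (\<lambda>b. Suc (f b)) ` {..<k}} = ?J" by auto
  have "{j. j < n \<and> j \<in> ?J} = ?J" using f(2) by auto
  moreover have "card ?J = k"
    using strict_mono_on_imp_inj_on[OF f(1)] by (simp add: card_image)
  ultimately have card: "card {j. j < n \<and> j \<in> ?J} = k" by simp
  show ?thesis
    unfolding maximal_minor_def col_det_def J
    by (rule arg_cong[where f = det])
       (use A card f in \<open>auto simp: submatrix_def pick_UNIV pick_image_strict_mono intro!: eq_matI\<close>)
qed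

text \<open>Selecting columns commutes with multiplication from the left. With
  \<open>row_space_factor\<close>, this makes the minors of two matrices with the same row space
  proportional.\<close>

lemma col_det_mult:
  assumes N: "N \<in> carrier_mat k k" and A: "A \<in> carrier_mat k n" and f: "f ` {..<k} \<subseteq> {..<n}"
  shows "col_det k (\<lambda>a c. (N * A) $$ (a, c)) f = det N * col_det k (\<lambda>a c. A $$ (a, c)) f"
proof -
  have fb: "f b < n" if "b < k" for b using f that by auto
  have "mat k k (\<lambda>(a, b). (N * A) $$ (a, f b)) = N * mat k k (\<lambda>(a, b). A $$ (a, f b))"
    using N A by (intro eq_matI) (auto simp: scalar_prod_def fb)
  then show ?thesis using N by (simp add: col_det_def det_mult)
qed

text \<open>The coefficients of the rows of \<open>B\<close> in terms of the rows of
  \<open>A\<close> form the rows of \<open>N\<close>. Invertibility of \<open>N\<close> is obtained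
  later from a nonzero minor.\<close>

lemma row_space_factor:
  assumes A: "A \<in> carrier_mat k n" and B: "B \<in> carrier_mat k n"
    and rows: "set (rows B) \<subseteq> vec_space.row_space n (A :: complex mat)"
  obtains N where "N \<in> carrier_mat k k" "B = N * A"
proof -
  interpret vec_space "TYPE(complex)" n .
  have "\<exists>y \<in> carrier_vec k. A\<^sup>T *\<^sub>v y = row B i" if "i < k" for i
    using rows row_space_eq[OF A] that A B by (auto simp: rows_def image_subset_iff)
  then obtain y where y: "y i \<in> carrier_vec k" "A\<^sup>T *\<^sub>v y i = row B i" if "i < k" for i
    by metis
  let ?N = "mat k k (\<lambda>(i, j). y i $ j)"
  have "B = ?N * A"
  proof (rule eq_matI)
    fix i j assume "i < dim_row (?N * A)" "j < dim_col (?N * A)"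
    then have ij: "i < k" "j < n" using A by auto
    have "B $$ (i, j) = (A\<^sup>T *\<^sub>v y i) $ j" using y(2)[OF ij(1)] B ij by simp
    also have "\<dots> = (?N * A) $$ (i, j)" using A ij y(1)[OF ij(1)] by (simp add: scalar_prod_def ac_simps)
    finally show "B $$ (i, j) = (?N * A) $$ (i, j)" .
  qed (use A B in auto)
  then show thesis by (intro that[of ?N]) auto
qed

text \<open>Sorting: \<open>g\<close> lists the values of \<open>f\<close> in increasing order and
  \<open>p b\<close> is the rank of \<open>f b\<close>.\<close>

lemma inj_on_factor_strict_mono:
  fixes f :: "nat \<Rightarrow> nat"
  assumes "inj_on f {..<k}"
  obtains g p where "strict_mono_on {..<k} g" "g ` {..<k} = f ` {..<k}" "p permutes {..<k}"
    "\<And>b. b < k \<Longrightarrow> f b = g (p b)"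
proof -
  let ?g = "pick (f ` {..<k})"
  have card: "card (f ` {..<k}) = k" using assms by (simp add: card_image)
  have g: "strict_mono_on {..<k} ?g" "?g ` {..<k} = f ` {..<k}"
    using strict_mono_on_pick[of "f ` {..<k}"] pick_image[of "f ` {..<k}"] by (simp_all add: card)
  have bg: "bij_betw (the_inv_into {..<k} ?g) (f ` {..<k}) {..<k}"
    using g strict_mono_on_imp_inj_on by (intro bij_betw_the_inv_into) (auto simp: bij_betw_def)
  define p where "p b = (if b < k then the_inv_into {..<k} ?g (f b) else b)" for b
  have "bij_betw (the_inv_into {..<k} ?g \<circ> f) {..<k} {..<k}"
    using assms bg by (intro bij_betw_trans[of f _ "f ` {..<k}"]) (auto simp: bij_betw_def)
  then have "bij_betw p {..<k} {..<k}"
    by (rule bij_betw_cong[THEN iffD1, rotated]) (simp add: p_def)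
  then have "p permutes {..<k}" by (rule bij_imp_permutes) (simp add: p_def)
  moreover have "f b = ?g (p b)" if "b < k" for b
    using that g strict_mono_on_imp_inj_on[OF g(1)] by (simp add: p_def f_the_inv_into_f)
  ultimately show thesis using g that by blast
qed

text \<open>Sorting the columns changes both factors by the same sign, and repeated columns give
  zero. Positivity known for column sets thus extends to all maps in the Cauchy--Binet sum.\<close>

lemma col_det_product_nonneg:
  assumes "\<And>g. strict_mono_on {..<k} g \<Longrightarrow> g ` {..<k} \<subseteq> {..<n} \<Longrightarrow>
      d * (col_det k F g * col_det k G g) \<in> \<real>\<^sub>\<ge>\<^sub>0"
    and f: "f ` {..<k} \<subseteq> {..<n}"
  shows "d * (col_det k F f * col_det k G f) \<in> \<real>\<^sub>\<ge>\<^sub>0"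
proof (cases "inj_on f {..<k}")
  case True
  then obtain g p where g: "strict_mono_on {..<k} g" "g ` {..<k} = f ` {..<k}" "p permutes {..<k}"
    "\<And>b. b < k \<Longrightarrow> f b = g (p b)" by (rule inj_on_factor_strict_mono) blast
  have eq: "col_det k H f = signof p * col_det k H g" for H
    by (subst col_det_permute[OF g(3), symmetric]) (auto intro!: col_det_cong simp: g)
  have "(signof p :: complex) * signof p = 1" by (simp add: sign_def)
  moreover have "d * (col_det k F f * col_det k G f)
      = (signof p * signof p) * (d * (col_det k F g * col_det k G g))"
    unfolding eq by (simp only: ac_simps)
  moreover have "d * (col_det k F g * col_det k G g) \<in> \<real>\<^sub>\<ge>\<^sub>0" using assms(1)[OF g(1)] f g(2) by simp
  ultimately show ?thesis by (simp only: mult_1)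
qed (simp add: col_det_not_inj)

section \<open>Spans of vectors of powers of roots\<close>

abbreviation powvec :: "nat \<Rightarrow> complex \<Rightarrow> complex vec" where
  "powvec n z \<equiv> vec n (\<lambda>i. z ^ i)"

text \<open>A geometric sum whose ratio \<open>z / w\<close> is an \<open>n\<close>th root of unity.
  This orthogonality relation drives independence, the eigenprojections and the final Cauchy--Binet
  argument.\<close>

lemma sum_ratio_powers:
  fixes z w :: complex
  assumes "z ^ n = w ^ n" and "w \<noteq> 0"
  shows "(\<Sum>i<n. z ^ i * inverse w ^ i) = (if z = w then of_nat n else 0)"
proof (cases "z = w")
  case True
  then show ?thesis using assms by (simp flip: power_mult_distrib)
next
  case False
  have "(z * inverse w) ^ n = 1" using assms by (simp add: power_mult_distrib power_inverse)
  moreover have "z * inverse w \<noteq> 1" using False assms(2) by (simp add: field_simps)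
  ultimately show ?thesis
    using geometric_sum[of "z * inverse w" n] False by (simp flip: power_mult_distrib)
qed

text \<open>Facts on the spans depend only on the equation \<open>z ^ n = c\<close>;
  \<open>c\<close> becomes \<open>twist k t\<close> once \<sigma> enters.\<close>

locale root_vectors =
  fixes n :: nat and c :: complex
  assumes n: "n \<ge> 1" and c: "c \<noteq> 0"
begin

sublocale vec_space "TYPE(complex)" n .

abbreviation Roots :: "complex set" where "Roots \<equiv> {z. z ^ n = c}"

text \<open>Coefficients are indexed by roots, not by vectors as in \<open>lincomb\<close>.\<close>

abbreviation comb :: "complex set \<Rightarrow> (complex \<Rightarrow> complex) \<Rightarrow> complex vec" where
  "comb S a \<equiv> vec n (\<lambda>i. \<Sum>z\<in>S. a z * z ^ i)"

lemma finite_Roots: "finite Roots" and card_Roots: "card Roots = n"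
  using c n finite_nth_roots[of n c] card_nth_roots[of c n] by auto

lemma root_nonzero: "z \<in> Roots \<Longrightarrow> z \<noteq> 0"
  using c n by (auto simp: power_0_left)

text \<open>Up to the factor \<open>n\<close>, the vectors of powers of \<open>inverse w\<close>
  form the basis dual to the \<open>powvec n z\<close>.\<close>

lemma comb_coeff:
  assumes S: "S \<subseteq> Roots" and w: "w \<in> Roots"
  shows "(\<Sum>i<n. comb S a $ i * inverse w ^ i) = (if w \<in> S then of_nat n * a w else 0)"
proof -
  have fin: "finite S" using S finite_Roots finite_subset by blast
  have "(\<Sum>i<n. comb S a $ i * inverse w ^ i) = (\<Sum>z\<in>S. a z * (\<Sum>i<n. z ^ i * inverse w ^ i))"
    by (simp add: sum_distrib_left sum_distrib_right mult.assoc) (rule sum.swap)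
  also have "\<dots> = (\<Sum>z\<in>S. if z = w then of_nat n * a w else 0)"
    using S w root_nonzero[OF w] by (intro sum.cong refl) (auto simp: sum_ratio_powers)
  also have "\<dots> = (if w \<in> S then of_nat n * a w else 0)"
    using fin by (simp add: sum.delta)
  finally show ?thesis .
qed

lemma powvec_eq_comb: "z \<in> S \<Longrightarrow> finite S \<Longrightarrow> powvec n z = comb S (\<lambda>w. if w = z then 1 else 0)"
  by (auto intro!: eq_vecI simp: if_distrib[of "\<lambda>x. x * _"] sum.delta' cong: if_cong)

lemma inj_on_powvec: "inj_on (powvec n) Roots"
proof (rule inj_onI)
  fix z w assume zw: "z \<in> Roots" "w \<in> Roots" "powvec n z = powvec n w"
  have "(\<Sum>i<n. z ^ i * inverse w ^ i) = (\<Sum>i<n. w ^ i * inverse w ^ i)"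
    using arg_cong[OF zw(3), of "\<lambda>v. \<Sum>i<n. v $ i * inverse w ^ i"] by simp
  then show "z = w"
    using zw root_nonzero[OF zw(2)] n by (auto simp: sum_ratio_powers split: if_splits)
qed

lemma lincomb_powvec:
  assumes S: "S \<subseteq> Roots"
  shows "lincomb a (powvec n ` S) = comb S (\<lambda>z. a (powvec n z))"
proof (rule eq_vecI)
  have carr: "powvec n ` S \<subseteq> carrier_vec n" by auto
  have fin: "finite (powvec n ` S)" using S finite_Roots finite_subset by blast
  show "dim_vec (lincomb a (powvec n ` S)) = dim_vec (comb S (\<lambda>z. a (powvec n z)))"
    using lincomb_dim[OF fin carr] by simp
  fix i assume "i < dim_vec (comb S (\<lambda>z. a (powvec n z)))"
  then show "lincomb a (powvec n ` S) $ i = comb S (\<lambda>z. a (powvec n z)) $ i"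
    using inj_on_subset[OF inj_on_powvec S]
    by (simp add: lincomb_index[OF _ carr] sum.reindex)
qed

lemma V_span_eq_range_comb:
  assumes S: "S \<subseteq> Roots"
  shows "V_span n S = range (comb S)"
proof -
  have fin: "finite (powvec n ` S)" using S finite_Roots finite_subset by blast
  have "V_span n S = {lincomb a (powvec n ` S) | a. True}"
    unfolding V_span_def using finite_span[OF fin] by (auto simp: image_subset_iff)
  also have "\<dots> = range (comb S)"
  proof safe
    fix a show "lincomb a (powvec n ` S) \<in> range (comb S)" unfolding lincomb_powvec[OF S] by (rule rangeI)
  next
    fix a :: "complex \<Rightarrow> complex"
    \<comment> \<open>Since distinct roots have distinct power vectors, coefficients on roots can be
      carried over to vectors.\<close>
    let ?b = "\<lambda>v. a (the_inv_into Roots (powvec n) v)"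
    have "?b (powvec n z) = a z" if "z \<in> S" for z
      using that S the_inv_into_f_f[OF inj_on_powvec, of z] by auto
    then have "comb S a = lincomb ?b (powvec n ` S)"
      unfolding lincomb_powvec[OF S] by (intro eq_vecI) (simp_all cong: sum.cong)
    then show "\<exists>b. comb S a = lincomb b (powvec n ` S) \<and> True" by blast
  qed
  finally show ?thesis .
qed

lemma powvec_in_V_span_iff:
  assumes S: "S \<subseteq> Roots" and w: "w \<in> Roots"
  shows "powvec n w \<in> V_span n S \<longleftrightarrow> w \<in> S"
proof
  assume "w \<in> S"
  then show "powvec n w \<in> V_span n S"
    using powvec_eq_comb[OF _ finite_subset[OF S finite_Roots]] by (auto simp: V_span_eq_range_comb[OF S])
next
  assume "powvec n w \<in> V_span n S"
  then obtain a where a: "powvec n w = comb S a" by (auto simp: V_span_eq_range_comb[OF S])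
  have "(\<Sum>i<n. comb S a $ i * inverse w ^ i) = of_nat n"
    using root_nonzero[OF w] w by (simp add: a[symmetric] sum_ratio_powers)
  then show "w \<in> S"
    using comb_coeff[OF S w, of a] n by (auto split: if_splits)
qed

lemma lin_indpt_powvec:
  assumes S: "S \<subseteq> Roots"
  shows "lin_indpt (powvec n ` S)"
proof (rule finite_lin_indpt2)
  show "finite (powvec n ` S)" using S finite_Roots finite_subset by blast
  show "powvec n ` S \<subseteq> carrier_vec n" by auto
  fix a assume "lincomb a (powvec n ` S) = 0\<^sub>v n"
  then have z: "comb S (\<lambda>z. a (powvec n z)) = 0\<^sub>v n" by (simp add: lincomb_powvec[OF S])
  have "a (powvec n w) = 0" if "w \<in> S" for w
    using comb_coeff[OF S, of w "\<lambda>z. a (powvec n z)"] that S n unfolding z by auto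
  then show "\<forall>v \<in> powvec n ` S. a v = 0" by auto
qed

text \<open>\<open>Gr\<close> measures dimension inside the subspace, so independence has to be
  moved from the ambient space to the span.\<close>

lemma dim_span_lin_indpt:
  assumes B: "finite B" "B \<subseteq> carrier_vec n" "lin_indpt B"
  shows "vectorspace.dim class_ring (V\<lparr>carrier := span B\<rparr>) = card B"
proof -
  have sub: "subspace class_ring (span B) V" using B span_is_subspace by simp
  interpret U: vectorspace class_ring "V\<lparr>carrier := span B\<rparr>"
    by (rule subspace_is_vs[OF sub])
  have sm: "submodule class_ring (span B) V" using sub by (simp add: subspace_def)
  have in_span: "B \<subseteq> span B" using B(2) by (rule in_own_span)
  have "U.basis B"
    unfolding U.basis_def using span_li_not_depend[OF in_span sm] in_span B(3) by simp
  then show ?thesis using U.dim_basis[OF B(1)] by simp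
qed

lemma V_span_in_Gr:
  assumes S: "S \<subseteq> Roots"
  shows "V_span n S \<in> Gr (card S) n"
proof -
  have B: "finite (powvec n ` S)" "powvec n ` S \<subseteq> carrier_vec n"
    using finite_subset[OF S finite_Roots] by auto
  have "card (powvec n ` S) = card S"
    using inj_on_subset[OF inj_on_powvec S] by (rule card_image)
  then show ?thesis
    unfolding Gr_def V_span_def
    using span_is_subspace[of "powvec n ` S"] B dim_span_lin_indpt[OF B lin_indpt_powvec[OF S]] by simp
qed

lemma every_vec_comb:
  assumes "v \<in> carrier_vec n"
  obtains a where "v = comb Roots a"
proof -
  have B: "finite (powvec n ` Roots)" "powvec n ` Roots \<subseteq> carrier_vec n"
    using finite_Roots by auto
  have "card (powvec n ` Roots) = n" using inj_on_powvec card_Roots by (simp add: card_image)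
  then have "basis (powvec n ` Roots)"
    using dim_li_is_basis[OF fin_dim B(1,2)] lin_indpt_powvec[of Roots] by (simp add: dim_is_n)
  then have "v \<in> V_span n Roots" using assms by (simp add: basis_def V_span_def)
  then show thesis using that by (auto simp: V_span_eq_range_comb)
qed

subsection \<open>Invariant subspaces\<close>

text \<open>Shifting the coordinates multiplies \<open>powvec n z\<close> by \<open>z\<close>; in
  the last coordinate this is the equation \<open>z ^ n = twist k t\<close>.\<close>

lemma \<sigma>_comb:
  assumes "twist k t = c" and S: "S \<subseteq> Roots"
  shows "\<sigma> k n t (comb S a) = comb S (\<lambda>z. a z * z)"
proof (rule eq_vecI)
  fix i assume "i < dim_vec (comb S (\<lambda>z. a z * z))"
  then have i: "i < n" by simp
  have "twist k t * a z = a z * z * z ^ i" if "z \<in> S" "\<not> Suc i < n" for z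
  proof -
    have "z ^ n = c" using that S by auto
    moreover have "n = Suc i" using that i by simp
    ultimately show ?thesis using assms(1) by simp
  qed
  then have "\<not> Suc i < n \<Longrightarrow> (\<Sum>z\<in>S. twist k t * a z) = (\<Sum>z\<in>S. a z * z * z ^ i)"
    by (intro sum.cong refl) auto
  then show "\<sigma> k n t (comb S a) $ i = comb S (\<lambda>z. a z * z) $ i"
    using i n by (simp add: \<sigma>_def sum_distrib_left mult.assoc)
qed (simp add: \<sigma>_def)

lemma \<sigma>_V_span:
  assumes "twist k t = c" and S: "S \<subseteq> Roots"
  shows "\<sigma> k n t ` V_span n S = V_span n S"
proof -
  \<comment> \<open>Dividing by the nonzero eigenvalues makes \<sigma> surjective on the span, so
    the image is all of it.\<close>
  have "\<exists>b. comb S a = comb S (\<lambda>z. b z * z)" for a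
  proof (intro exI[of _ "\<lambda>z. a z / z"] eq_vecI)
    fix i assume "i < dim_vec (comb S (\<lambda>z. a z / z * z))"
    then show "comb S a $ i = comb S (\<lambda>z. a z / z * z) $ i"
      using S root_nonzero by (auto intro!: sum.cong)
  qed simp
  then show ?thesis
    unfolding V_span_eq_range_comb[OF S] image_image \<sigma>_comb[OF assms] by (auto simp: image_iff)
qed

lemma submodule_sum:
  assumes "submodule class_ring W V" "finite A" "\<And>x. x \<in> A \<Longrightarrow> u x \<in> W"
  shows "vec n (\<lambda>i. \<Sum>x\<in>A. b x * u x $ i) \<in> W"
  using assms(2,3)
proof (induction A rule: finite_induct)
  case empty
  then show ?case
    using submodule.zero_closed[OF assms(1)] by (simp add: module_vec_simps zero_vec_def)
next
  case (insert x A)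
  let ?s = "vec n (\<lambda>i. \<Sum>y\<in>A. b y * u y $ i)"
  have "u x \<in> carrier_vec n"
    using insert submodule.subset[OF assms(1)] by (auto simp: module_vec_simps)
  then have "vec n (\<lambda>i. \<Sum>y\<in>insert x A. b y * u y $ i) = b x \<cdot>\<^sub>v u x + ?s"
    using insert by (auto intro!: eq_vecI)
  moreover have "b x \<cdot>\<^sub>v u x \<in> W"
    using submodule.smult_closed[OF assms(1), of "b x" "u x"] insert by (simp add: module_vec_simps)
  moreover have "?s \<in> W" using insert by simp
  ultimately show ?case
    using submodule.m_closed[OF assms(1), of "b x \<cdot>\<^sub>v u x" ?s] by (simp add: module_vec_simps)
qed

text \<open>The operator \<open>\<Sum>\<^sub>m w\<^sup>-\<^sup>m \<sigma>\<^sup>m\<close> is \<open>n\<close> times the projection to the eigenvector of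
  eigenvalue \<open>w\<close>, so an invariant subspace contains the eigencomponents of its elements.\<close>

lemma powvec_in_invariant_subspace:
  assumes tw: "twist k t = c" and W: "submodule class_ring W V" "\<sigma> k n t ` W \<subseteq> W"
    and a: "comb Roots a \<in> W" and w: "w \<in> Roots" "a w \<noteq> 0"
  shows "powvec n w \<in> W"
proof -
  let ?u = "\<lambda>m. comb Roots (\<lambda>z. a z * z ^ m)"
  have u: "?u m \<in> W" for m
  proof (induction m)
    case (Suc m)
    have "?u (Suc m) = \<sigma> k n t (?u m)"
      by (subst \<sigma>_comb[OF tw subset_refl]) (simp add: ac_simps)
    then show ?case using Suc W(2) by auto
  qed (use a in simp)
  \<comment> \<open>Dividing also by \<open>of_nat n * a w\<close> scales the projected component to
    \<open>powvec n w\<close> itself.\<close>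
  let ?b = "\<lambda>m. inverse w ^ m / (of_nat n * a w)"
  have "powvec n w = vec n (\<lambda>i. \<Sum>m<n. ?b m * ?u m $ i)"
  proof (rule eq_vecI)
    fix i assume "i < dim_vec (vec n (\<lambda>i. \<Sum>m<n. ?b m * ?u m $ i))"
    then have i: "i < n" by simp
    have "(\<Sum>m<n. ?b m * ?u m $ i)
        = (\<Sum>m<n. \<Sum>z\<in>Roots. a z * z ^ i / (of_nat n * a w) * (z ^ m * inverse w ^ m))"
      using i by (simp add: sum_distrib_left ac_simps)
    also have "\<dots> = (\<Sum>z\<in>Roots. a z * z ^ i / (of_nat n * a w) * (\<Sum>m<n. z ^ m * inverse w ^ m))"
      by (subst sum.swap) (simp add: sum_distrib_left)
    also have "\<dots> = (\<Sum>z\<in>Roots. if z = w then w ^ i else 0)"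
      using w n root_nonzero[OF w(1)] by (intro sum.cong refl) (auto simp: sum_ratio_powers)
    also have "\<dots> = w ^ i" using w finite_Roots by (simp add: sum.delta)
    finally show "powvec n w $ i = vec n (\<lambda>i. \<Sum>m<n. ?b m * ?u m $ i) $ i" using i by simp
  qed simp
  then show ?thesis using submodule_sum[OF W(1) finite_lessThan[of n] u, of ?b "\<lambda>m. m"] by (simp only:)
qed

text \<open>Expanding an element of \<open>W\<close> in the full eigenbasis, only roots whose power
  vectors lie in \<open>W\<close> can have nonzero coefficients, by the projections above.\<close>

lemma invariant_subspace_eq_V_span:
  assumes tw: "twist k t = c" and W: "submodule class_ring W V" "\<sigma> k n t ` W \<subseteq> W"
  shows "W = V_span n {z \<in> Roots. powvec n z \<in> W}"
proof (intro subset_antisym subsetI)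
  let ?S = "{z \<in> Roots. powvec n z \<in> W}"
  have S: "?S \<subseteq> Roots" by auto
  have fin: "finite ?S" using finite_Roots by simp
  {
    fix v assume v: "v \<in> W"
    then have "v \<in> carrier_vec n"
      using submodule.subset[OF W(1)] by (auto simp: module_vec_simps)
    then obtain a where a: "v = comb Roots a" by (rule every_vec_comb)
    have "a z = 0" if "z \<in> Roots - ?S" for z
      using powvec_in_invariant_subspace[OF assms, of a z] v a that by auto
    then have "(\<Sum>z\<in>Roots. a z * z ^ i) = (\<Sum>z\<in>?S. a z * z ^ i)" for i
      using finite_Roots by (intro sum.mono_neutral_right) auto
    then have "v = comb ?S a" by (simp add: a)
    then show "v \<in> V_span n ?S" unfolding V_span_eq_range_comb[OF S] by (intro range_eqI[of _ _ a])
  }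
  fix v assume "v \<in> V_span n ?S"
  then obtain a where a: "v = comb ?S a" unfolding V_span_eq_range_comb[OF S] by (elim rangeE)
  have "v = vec n (\<lambda>i. \<Sum>z\<in>?S. a z * powvec n z $ i)" unfolding a by auto
  then show "v \<in> W" using submodule_sum[OF W(1) fin, of "powvec n" a] by simp
qed

lemma inj_on_V_span: "inj_on (V_span n) (Pow Roots)"
proof (rule inj_onI)
  fix S T assume ST: "S \<in> Pow Roots" "T \<in> Pow Roots" "V_span n S = V_span n T"
  then have "z \<in> S \<longleftrightarrow> z \<in> T" if "z \<in> Roots" for z
    using powvec_in_V_span_iff[of S z] powvec_in_V_span_iff[of T z] that by auto
  then show "S = T" using ST by auto
qed

lemma fixed_points_eq:
  assumes tw: "twist k t = c"
  shows "{V \<in> Gr k n. \<sigma> k n t ` V = V} = V_span n ` root_subsets k n t"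
proof (intro subset_antisym subsetI)
  fix W assume "W \<in> {V \<in> Gr k n. \<sigma> k n t ` V = V}"
  then have W: "W \<in> Gr k n" "\<sigma> k n t ` W = W" by auto
  let ?S = "{z \<in> Roots. powvec n z \<in> W}"
  have "W = V_span n ?S"
    using W by (intro invariant_subspace_eq_V_span[OF tw]) (auto simp: Gr_def subspace_def)
  moreover have "V_span n ?S \<in> Gr (card ?S) n" by (rule V_span_in_Gr) auto
  ultimately have "card ?S = k" using W(1) by (simp add: Gr_def)
  then have "?S \<in> root_subsets k n t" using tw by (auto simp: root_subsets_def)
  then show "W \<in> V_span n ` root_subsets k n t" using \<open>W = V_span n ?S\<close> by blast
next
  fix W assume "W \<in> V_span n ` root_subsets k n t"
  then obtain S where S: "S \<subseteq> Roots" "card S = k" "W = V_span n S"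
    using tw by (auto simp: root_subsets_def)
  then show "W \<in> {V \<in> Gr k n. \<sigma> k n t ` V = V}"
    using V_span_in_Gr[OF S(1)] \<sigma>_V_span[OF tw S(1)] by auto
qed

lemma card_fixed_points:
  assumes tw: "twist k t = c"
  shows "card {V \<in> Gr k n. \<sigma> k n t ` V = V} = n choose k"
proof -
  have "root_subsets k n t \<subseteq> Pow Roots" using tw by (auto simp: root_subsets_def)
  then have "card (V_span n ` root_subsets k n t) = card (root_subsets k n t)"
    by (intro card_image inj_on_subset[OF inj_on_V_span])
  then show ?thesis
    using n_subsets[OF finite_Roots, of k] tw
    by (simp add: fixed_points_eq[OF tw] root_subsets_def card_Roots)
qed

end

lemma twist_nonzero: "t \<noteq> 0 \<Longrightarrow> twist k t \<noteq> 0"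
  by (simp add: twist_def power_int_eq_0_iff)

section \<open>Minors for the distinguished set of roots\<close>

definition S0_root :: "nat \<Rightarrow> nat \<Rightarrow> nat \<Rightarrow> complex" where
  "S0_root k n j = cis ((real k - 1 - 2 * real j) * pi / real n)"

lemma S\<^sub>0_eq: "S\<^sub>0 k n = S0_root k n ` {..<k}"
  unfolding S\<^sub>0_def S0_root_def cis_conv_exp lessThan_def ..

lemma S0_root_power:
  assumes "1 \<le> n" "j < k"
  shows "S0_root k n j ^ n = (-1) powi (int k - 1)"
proof -
  have "S0_root k n j ^ n = cis ((real k - 1) * pi - 2 * pi * real j)"
    using assms(1) 
  proof -
    have "real n * ((real k - 1 - 2 * real j) * pi / real n) = (real k - 1) * pi - 2 * pi * real j"
      using assms(1) by (simp add: field_simps)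
    then show ?thesis by (simp only: S0_root_def DeMoivre)
  qed
  \<comment> \<open>As \<open>j < k\<close> makes \<open>k\<close> positive, the natural number
    \<open>k - 1\<close> agrees with the integer exponent.\<close>
  also have "\<dots> = cis (real (k - 1) * pi)"
    using assms(2) by (simp add: cis_divide[symmetric] of_nat_diff cis_multiple_2pi)
  also have "\<dots> = (-1) ^ (k - 1)" using DeMoivre[of pi "k - 1"] by simp
  also have "\<dots> = (-1) powi (int k - 1)"
    using assms(2) by (simp add: power_int_def nat_diff_distrib of_nat_diff)
  finally show ?thesis .
qed

text \<open>The angles are symmetric about 0, so inversion reverses the enumeration. Hence the
  inverses of \<open>r S\<^sub>0\<close> are \<open>(1/r) S\<^sub>0\<close>, to which the sine
  formula applies again.\<close>

lemma inverse_S0_root: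
  assumes "j < k"
  shows "inverse (S0_root k n j) = S0_root k n (k - 1 - j)"
proof -
  have "- (real k - 1 - 2 * real j) = real k - 1 - 2 * real (k - 1 - j)"
    using assms by (simp add: of_nat_diff)
  then show ?thesis
    unfolding S0_root_def cis_inverse by (metis minus_divide_left mult_minus_left)
qed

text \<open>Each index lies in exactly \<open>k - 1\<close> pairs.\<close>

lemma prod_pairs_eq_power:
  fixes g :: "nat \<Rightarrow> 'a :: comm_monoid_mult"
  shows "(\<Prod>b<k. \<Prod>l<b. g b * g l) = (\<Prod>b<k. g b ^ (k - 1))"
proof (induction k)
  case (Suc k)
  show ?case
  proof (cases k)
    case (Suc m)
    have "(\<Prod>b<Suc k. \<Prod>l<b. g b * g l) = (\<Prod>b<k. g b ^ (k - 1)) * (g k ^ k * (\<Prod>l<k. g l))"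
      unfolding prod.lessThan_Suc[of _ k] Suc.IH by (simp add: prod.distrib)
    also have "\<dots> = (\<Prod>b<k. g b ^ (k - 1) * g b) * g k ^ k"
      by (simp add: prod.distrib ac_simps)
    also have "\<dots> = (\<Prod>b<Suc k. g b ^ (Suc k - 1))"
      using Suc by (simp add: power_Suc2[symmetric] del: power_Suc)
    finally show ?thesis .
  qed simp
qed simp

text \<open>Factoring out the midpoint of the two angles leaves a difference of conjugate unit
  numbers, which is a sine.\<close>

lemma cis_minus_diff: "cis (- 2 * x) - cis (- 2 * y) = cis (- x) * cis (- y) * (- 2 * \<i> * sin (x - y))"
proof -
  have "cis (- 2 * x) = cis (- x) * cis (- y) * cis (y - x)"
    and "cis (- 2 * y) = cis (- x) * cis (- y) * cis (x - y)"
    by (simp_all add: cis_mult)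
  moreover have "cis (y - x) - cis (x - y) = - 2 * \<i> * sin (x - y)"
    using sin_minus[of "x - y"] cos_minus[of "x - y"] by (simp add: complex_eq_iff)
  ultimately show ?thesis by (simp only: right_diff_distrib[symmetric])
qed

text \<open>The scalar \<open>(-2i)^(k(k-1)/2)\<close>, one factor for each pair in the Vandermonde
  product.\<close>

definition sine_const :: "nat \<Rightarrow> complex" where
  "sine_const k = (\<Prod>b<k. \<Prod>l<b. - 2 * \<i>)"

lemma sine_const_nonzero: "sine_const k \<noteq> 0"
  by (simp add: sine_const_def)

text \<open>With \<open>\<theta> c = c \<pi> / n\<close>, column \<open>c\<close> is
  \<open>r^c\<close> times a phase of angle \<open>(k - 1) \<theta> c\<close> times the powers of
  \<open>cis (- 2 * \<theta> c)\<close>. The midpoint phases of the Vandermonde factors contribute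
  \<open>- (k - 1) \<theta> c\<close> per column and cancel the first phase, which is why
  \<open>S\<^sub>0\<close> is centred at angle 0.\<close>

lemma col_det_S0:
  assumes n: "1 \<le> n"
  shows "col_det k (\<lambda>a c. (of_real r * S0_root k n a) ^ c) f =
    sine_const k * of_real (r ^ (\<Sum>b<k. f b) *
      (\<Prod>b<k. \<Prod>l<b. sin ((real (f b) - real (f l)) / real n * pi)))"
proof -
  define \<theta> where "\<theta> c = real c / real n * pi" for c
  define g where "g c = cis (- \<theta> c)" for c
  define s where "s = sine_const k * (\<Prod>b<k. \<Prod>l<b. of_real (sin (\<theta> (f b) - \<theta> (f l))))"
  have entry: "(of_real r * S0_root k n a) ^ c =
      (of_real r ^ c * cis ((real k - 1) * \<theta> c)) * cis (- 2 * \<theta> c) ^ a" for a c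
    by (simp add: S0_root_def \<theta>_def power_mult_distrib DeMoivre cis_mult algebra_simps
        diff_divide_distrib add_divide_distrib)
  have "col_det k (\<lambda>a c. (of_real r * S0_root k n a) ^ c) f
      = (\<Prod>b<k. of_real r ^ f b * cis ((real k - 1) * \<theta> (f b))) *
        (\<Prod>b<k. \<Prod>l<b. cis (- 2 * \<theta> (f b)) - cis (- 2 * \<theta> (f l)))"
    unfolding entry
      col_det_scale_cols[of k "\<lambda>c. of_real r ^ c * cis ((real k - 1) * \<theta> c)"
        "\<lambda>a c. cis (- 2 * \<theta> c) ^ a"]
    by (simp only: col_det_def vandermonde_det)
  moreover have "(\<Prod>b<k. \<Prod>l<b. cis (- 2 * \<theta> (f b)) - cis (- 2 * \<theta> (f l)))
      = (\<Prod>b<k. g (f b) ^ (k - 1)) * s"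
    unfolding prod_pairs_eq_power[symmetric] cis_minus_diff sine_const_def g_def s_def
    by (simp only: prod.distrib mult.assoc)
  moreover have "(\<Prod>b<k. of_real r ^ f b * cis ((real k - 1) * \<theta> (f b))) *
      (\<Prod>b<k. g (f b) ^ (k - 1)) = (\<Prod>b<k. complex_of_real r ^ f b)"
    unfolding prod.distrib[symmetric]
  proof (intro prod.cong refl)
    fix b assume "b \<in> {..<k}"
    then have "cis ((real k - 1) * \<theta> (f b)) * g (f b) ^ (k - 1) = 1"
      by (simp add: g_def DeMoivre cis_mult of_nat_diff algebra_simps)
    then show "of_real r ^ f b * cis ((real k - 1) * \<theta> (f b)) * g (f b) ^ (k - 1)
        = complex_of_real r ^ f b" by (simp add: mult.assoc)
  qed
  ultimately have "col_det k (\<lambda>a c. (of_real r * S0_root k n a) ^ c) f =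
      (\<Prod>b<k. of_real r ^ f b) * s"
    by (simp only: mult.assoc[symmetric])
  moreover have "\<theta> a - \<theta> b = (real a - real b) / real n * pi" for a b
    by (simp add: \<theta>_def diff_divide_distrib left_diff_distrib)
  ultimately show ?thesis by (simp add: s_def power_sum mult.left_commute)
qed

lemma prod_pairs_strict_mono_image:
  fixes h :: "nat \<Rightarrow> nat" and q :: "nat \<Rightarrow> nat \<Rightarrow> 'a :: comm_monoid_mult"
  assumes h: "strict_mono_on {..<k} h"
  shows "(\<Prod>(i, j) \<in> {(i, j). i \<in> h ` {..<k} \<and> j \<in> h ` {..<k} \<and> i < j}. q i j)
    = (\<Prod>b<k. \<Prod>l<b. q (h l) (h b))"
proof -
  let ?T = "{(i, j). i \<in> h ` {..<k} \<and> j \<in> h ` {..<k} \<and> i < j}"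
  have "bij_betw (\<lambda>(b, l). (h l, h b)) (SIGMA b:{..<k}. {..<b}) ?T"
    unfolding bij_betw_def
  proof
    show "inj_on (\<lambda>(b, l). (h l, h b)) (SIGMA b:{..<k}. {..<b})"
      using strict_mono_on_imp_inj_on[OF h] by (auto simp: inj_on_def)
    show "(\<lambda>(b, l). (h l, h b)) ` (SIGMA b:{..<k}. {..<b}) = ?T"
    proof (intro subset_antisym subsetI)
      fix p assume "p \<in> ?T"
      then obtain l b where p: "p = (h l, h b)" "l < k" "b < k" "h l < h b" by auto
      then have "l < b" using strict_mono_on_less[OF h] by simp
      then show "p \<in> (\<lambda>(b, l). (h l, h b)) ` (SIGMA b:{..<k}. {..<b})"
        using p by (intro image_eqI[of _ _ "(b, l)"]) auto
    qed (use strict_mono_on_less[OF h] in auto)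
  qed
  then have "(\<Prod>(b, l) \<in> (SIGMA b:{..<k}. {..<b}). q (h l) (h b)) = (\<Prod>(i, j) \<in> ?T. q i j)"
    using prod.reindex_bij_betw[of "\<lambda>(b, l). (h l, h b)" _ ?T "\<lambda>(i, j). q i j"]
    by (simp add: case_prod_unfold)
  then show ?thesis by (simp add: prod.Sigma)
qed

section \<open>Total nonnegativity\<close>

text \<open>The minor in the first \<open>k\<close> columns is a Vandermonde determinant; it serves
  as the nonzero reference minor.\<close>

lemma col_det_powers_nonzero:
  assumes "inj_on e {..<k}"
  shows "col_det k (\<lambda>a c. e a ^ c) (\<lambda>b. b) \<noteq> 0"
proof -
  have "col_det k (\<lambda>a c. e a ^ c) (\<lambda>b. b) = (\<Prod>b<k. \<Prod>l<b. e b - e l)"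
    by (simp add: col_det_transpose vandermonde_det)
  moreover have "e b \<noteq> e l" if "b < k" "l < b" for b l
    using inj_onD[OF assms, of b l] that by auto
  ultimately show ?thesis by simp
qed

section \<open>Matrices whose rows are the powers of chosen roots\<close>

lemma root_subset_enum:
  assumes n: "1 \<le> n" and t: "t \<noteq> 0" and S: "S \<in> root_subsets k n t"
  obtains e where "bij_betw e {..<k} S" "\<And>a. a < k \<Longrightarrow> e a ^ n = twist k t"
    "\<And>a. a < k \<Longrightarrow> e a \<noteq> 0"
proof -
  have tw: "twist k t \<noteq> 0" using t by (rule twist_nonzero)
  have S': "S \<subseteq> {z. z ^ n = twist k t}" "card S = k" using S by (auto simp: root_subsets_def)
  have "finite S" using S'(1) finite_nth_roots[of n "twist k t"] n finite_subset by auto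
  then obtain e where e: "bij_betw e {..<k} S"
    using ex_bij_betw_nat_finite[of S] S'(2) by (auto simp: atLeast0LessThan)
  have "e a ^ n = twist k t" if "a < k" for a
    using bij_betwE[OF e] S'(1) that by auto
  moreover have "e a \<noteq> 0" if "a < k" for a
    using calculation[OF that] tw n by (auto simp: power_0_left)
  ultimately show thesis using that e by blast
qed

lemma set_rows_power_matrix:
  assumes "bij_betw e {..<k} S"
  shows "set (rows (mat k n (\<lambda>(a, c). e a ^ c))) = powvec n ` S"
proof -
  have "row (mat k n (\<lambda>(a, c). e a ^ c)) i = powvec n (e i)" if "i < k" for i
    using that by (auto intro!: eq_vecI)
  moreover have "S = e ` {..<k}" using assms by (simp add: bij_betw_def)
  ultimately show ?thesis
    by (auto simp: rows_def atLeast0LessThan image_image intro!: image_cong)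
qed

lemma row_space_power_matrix:
  assumes "bij_betw e {..<k} S"
  shows "vec_space.row_space n (mat k n (\<lambda>(a, c). e a ^ c)) = V_span n S"
  unfolding vec_space.row_space_def set_rows_power_matrix[OF assms] V_span_def ..

lemma col_det_power_matrix:
  assumes "f ` {..<k} \<subseteq> {..<n}"
  shows "col_det k (\<lambda>a c. mat k n (\<lambda>(a, c). e a ^ c) $$ (a, c)) f = col_det k (\<lambda>a c. e a ^ c) f"
  using assms by (intro col_det_cong) auto

lemma plucker_coords_V_spanI:
  assumes "V_span n S \<in> Gr k n" and e: "bij_betw e {..<k} S" and d: "d \<noteq> 0"
    and p: "\<And>f. strict_mono_on {..<k} f \<Longrightarrow> f ` {..<k} \<subseteq> {..<n} \<Longrightarrow>
      p ((\<lambda>b. Suc (f b)) ` {..<k}) = d * col_det k (\<lambda>a c. e a ^ c) f"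
  shows "plucker_coords k n (V_span n S) p"
  unfolding plucker_coords_def
proof (intro conjI bexI exI ballI)
  let ?A = "mat k n (\<lambda>(a, c). e a ^ c)"
  show "vec_space.row_space n ?A = V_span n S" by (rule row_space_power_matrix[OF e])
  fix I assume "I \<in> k_subsets k n"
  then show "p I = d * maximal_minor ?A I"
    by (auto simp: k_subsets_iff p maximal_minor_eq_col_det[of ?A k n] col_det_power_matrix)
qed (use assms in auto)

text \<open>Nonnegativity is given for some matrix with row space \<open>V_span n S\<close>; the
  factor \<open>N\<close> transfers it to the explicit power matrix. Its nonzero reference minor
  forces \<open>det N \<noteq> 0\<close>.\<close>

lemma totally_nonneg_V_spanD:
  assumes "totally_nonneg k n (V_span n S)" and e: "bij_betw e {..<k} S" and "k \<le> n"
  obtains d where "d \<noteq> 0" "\<And>f. strict_mono_on {..<k} f \<Longrightarrow> f ` {..<k} \<subseteq> {..<n} \<Longrightarrow>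
      d * col_det k (\<lambda>a c. e a ^ c) f \<in> \<real>\<^sub>\<ge>\<^sub>0"
proof -
  let ?B = "mat k n (\<lambda>(a, c). e a ^ c)"
  obtain p A c where A: "A \<in> carrier_mat k n" "vec_space.row_space n A = V_span n S" "c \<noteq> 0"
    and p: "\<And>I. I \<in> k_subsets k n \<Longrightarrow> p I = c * maximal_minor A I" "\<And>I. I \<in> k_subsets k n \<Longrightarrow> p I \<in> \<real>\<^sub>\<ge>\<^sub>0"
    using assms(1) unfolding totally_nonneg_def plucker_coords_def by blast
  interpret vec_space "TYPE(complex)" n .
  have "set (rows ?B) \<subseteq> row_space A"
    unfolding A(2) set_rows_power_matrix[OF e] V_span_def by (rule in_own_span) auto
  then obtain N where N: "N \<in> carrier_mat k k" "?B = N * A"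
    using row_space_factor[of A k n ?B] A(1) by auto
  have minor: "col_det k (\<lambda>a c. e a ^ c) f = det N * col_det k (\<lambda>a c. A $$ (a, c)) f"
    if "f ` {..<k} \<subseteq> {..<n}" for f
    using col_det_mult[OF N(1) A(1) that] col_det_power_matrix[OF that, of e] by (simp add: N(2))
  have "inj_on e {..<k}" using e by (simp add: bij_betw_def)
  then have "det N \<noteq> 0"
    using minor[of "\<lambda>b. b"] col_det_powers_nonzero[of e k] assms(3) by auto
  moreover have "c / det N * col_det k (\<lambda>a c. e a ^ c) f \<in> \<real>\<^sub>\<ge>\<^sub>0"
    if f: "strict_mono_on {..<k} f" "f ` {..<k} \<subseteq> {..<n}" for f
  proof -
    have I: "(\<lambda>b. Suc (f b)) ` {..<k} \<in> k_subsets k n" using f by (auto simp: k_subsets_iff)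
    have "c / det N * col_det k (\<lambda>a c. e a ^ c) f = c * col_det k (\<lambda>a c. A $$ (a, c)) f"
      using minor[OF f(2)] \<open>det N \<noteq> 0\<close> by simp
    then show ?thesis using p[OF I] maximal_minor_eq_col_det[OF A(1) f] by simp
  qed
  ultimately show thesis using A(3) by (intro that[of "c / det N"]) auto
qed

lemma nonneg_Reals_divide: "x \<in> \<real>\<^sub>\<ge>\<^sub>0 \<Longrightarrow> y \<in> \<real>\<^sub>\<ge>\<^sub>0 \<Longrightarrow> x / y \<in> \<real>\<^sub>\<ge>\<^sub>0" for x y :: complex
  by (metis divide_inverse nonneg_Reals_inverse_I nonneg_Reals_mult_I)

lemma totally_nonneg_imp_pos_real:
  assumes k: "0 < k" "k < n" and t: "t \<noteq> 0"
    and e: "inj_on e {..<k}" "\<And>a. a < k \<Longrightarrow> e a ^ n = twist k t" "\<And>a. a < k \<Longrightarrow> e a \<noteq> 0"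
    and d: "d \<noteq> 0" "\<And>f. strict_mono_on {..<k} f \<Longrightarrow> f ` {..<k} \<subseteq> {..<n} \<Longrightarrow>
      d * col_det k (\<lambda>a c. e a ^ c) f \<in> \<real>\<^sub>\<ge>\<^sub>0"
  shows "pos_real t"
proof -
  define D where "D = col_det k (\<lambda>a c. e a ^ c)"
  define \<mu> where "\<mu> = (\<Prod>a<k. e a)"
  \<comment> \<open>The column set \<open>{1..k-1, n}\<close>, numbered from 0.\<close>
  define h where "h b = (if b = k - 1 then n - 1 else b)" for b
  have shift: "D (\<lambda>b. Suc (f b)) = \<mu> * D f" for f
    unfolding D_def \<mu>_def
    by (subst col_det_scale_rows[symmetric]) (simp add: col_det_def)
  have V: "D (\<lambda>b. b) \<noteq> 0" unfolding D_def using e(1) by (rule col_det_powers_nonzero)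
  \<comment> \<open>The shift takes the last column of \<open>h\<close> to exponent
    \<open>n\<close>, where all entries equal \<open>twist k t\<close>. Moving this constant column
    to the front costs \<open>(-1) ^ (k - 1)\<close>, which cancels the sign in
    \<open>twist\<close>.\<close>
  have "\<mu> * D h = D (\<lambda>b. if b = k - 1 then n else Suc b)"
    unfolding shift[symmetric] unfolding D_def 
    by (rule col_det_cong) (use k in \<open>auto simp: h_def power_eq_if[of _ n]\<close>)
  also have "\<dots> = t * D (\<lambda>b. b)"
  proof -
    let ?M = "mat k k (\<lambda>(a, b). e a ^ (if b = k - 1 then n else Suc b))"
    have "(-1) ^ (k - 1) * det ?M = det (swap_col_to_front ?M (k - 1))"
      using k by (subst swap_col_to_front_det[of _ k]) auto
    also have "swap_col_to_front ?M (k - 1) =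
        mat k k (\<lambda>(a, b). (if b = 0 then twist k t else 1) * e a ^ b)"
      using k e(2) by (subst swap_col_to_front_result[of _ k k]) (auto intro!: eq_matI)
    also have "det \<dots> = twist k t * D (\<lambda>b. b)"
    proof -
      have "det (mat k k (\<lambda>(a, b). (if b = 0 then twist k t else 1) * e a ^ b)) =
          (\<Prod>b<k. if b = 0 then twist k t else 1) * D (\<lambda>b. b)"
        using col_det_scale_cols[of k "\<lambda>c. if c = 0 then twist k t else 1" "\<lambda>a c. e a ^ c" "\<lambda>b. b"]
        by (simp add: col_det_def D_def)
      also have "(\<Prod>b<k. if b = 0 then twist k t else 1) = twist k t"
        using k(1) by (cases k) (simp_all add: prod.lessThan_Suc_shift del: prod.lessThan_Suc)
      finally show ?thesis .
    qed
    also have "twist k t = (-1) ^ (k - 1) * t"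
      using k by (simp add: twist_def power_int_def nat_diff_distrib)
    finally show ?thesis by (simp add: D_def col_det_def)
  qed
  finally have cyc: "\<mu> * D h = t * D (\<lambda>b. b)" .
  have nn: "d * D f \<in> \<real>\<^sub>\<ge>\<^sub>0" if "strict_mono_on {..<k} f" "f ` {..<k} \<subseteq> {..<n}" for f
    unfolding D_def using d(2)[OF that] .
  have id: "d * D (\<lambda>b. b) \<in> \<real>\<^sub>\<ge>\<^sub>0"
    by (rule nn) (use k in \<open>auto intro: strict_mono_onI\<close>)
  have "d * D Suc \<in> \<real>\<^sub>\<ge>\<^sub>0"
    by (rule nn) (use k in \<open>auto intro: strict_mono_onI\<close>)
  \<comment> \<open>Quotients of minors no longer depend on the unknown scalar
    \<open>d\<close>.\<close>
  then have "d * D Suc / (d * D (\<lambda>b. b)) \<in> \<real>\<^sub>\<ge>\<^sub>0" using id by (rule nonneg_Reals_divide)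
  then have \<mu>: "\<mu> \<in> \<real>\<^sub>\<ge>\<^sub>0" using shift[of "\<lambda>b. b"] V d(1) by simp
  have "d * D h \<in> \<real>\<^sub>\<ge>\<^sub>0"
    by (rule nn) (use k in \<open>auto simp: h_def intro!: strict_mono_onI\<close>)
  then have "\<mu> * (d * D h) / (d * D (\<lambda>b. b)) \<in> \<real>\<^sub>\<ge>\<^sub>0"
    by (rule nonneg_Reals_divide[OF nonneg_Reals_mult_I[OF \<mu>] id])
  moreover have "\<mu> * (d * D h) / (d * D (\<lambda>b. b)) = t"
    using cyc V d(1) by (simp add: field_simps)
  ultimately have "t \<in> \<real>\<^sub>\<ge>\<^sub>0" by simp
  then show ?thesis using t
    by (auto simp: pos_real_def complex_nonneg_Reals_iff complex_is_Real_iff complex_eq_iff)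
qed

text \<open>Two columns differ by more than 0 and less than \<open>n\<close>, so every angle lies
  strictly between 0 and \<pi>.\<close>

lemma sine_product_pos:
  fixes f :: "nat \<Rightarrow> nat"
  assumes f: "strict_mono_on {..<k} f" "f ` {..<k} \<subseteq> {..<n}"
  shows "(\<Prod>b<k. \<Prod>l<b. sin ((real (f b) - real (f l)) / real n * pi)) > 0"
proof (intro prod_pos)
  fix b l assume "b \<in> {..<k}" "l \<in> {..<b}"
  then have "f l < f b" "f b < n" using f(2) strict_mono_onD[OF f(1), of l b] less_trans[of l b k] by auto
  then have "0 < (real (f b) - real (f l)) / real n" "(real (f b) - real (f l)) / real n < 1"
    by (auto simp: field_simps)
  then have "0 < (real (f b) - real (f l)) / real n * pi" "(real (f b) - real (f l)) / real n * pi < pi"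
    using mult_strict_right_mono[OF _ pi_gt_zero, of "(real (f b) - real (f l)) / real n" 1]
    by (simp_all only: mult_pos_pos pi_gt_zero mult_1)
  then show "sin ((real (f b) - real (f l)) / real n * pi) > 0" by (rule sin_gt_zero)
qed

lemma totally_nonneg_imp_eq_scaled_S\<^sub>0:
  assumes n: "1 \<le> n" and k: "k \<le> n" and r: "0 < r"
    and e: "bij_betw e {..<k} S" "\<And>a. a < k \<Longrightarrow> e a ^ n = of_real (r ^ n) * (-1) powi (int k - 1)"
    and d: "d \<noteq> 0" "\<And>f. strict_mono_on {..<k} f \<Longrightarrow> f ` {..<k} \<subseteq> {..<n} \<Longrightarrow>
      d * col_det k (\<lambda>a c. e a ^ c) f \<in> \<real>\<^sub>\<ge>\<^sub>0"
  shows "S = (\<lambda>z. complex_of_real r * z) ` S\<^sub>0 k n"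
proof (rule ccontr)
  let ?T = "(\<lambda>z. complex_of_real r * z) ` S\<^sub>0 k n"
  define F where "F a c = e a ^ c" for a c
  define G where "G a c = (complex_of_real (1 / r) * S0_root k n a) ^ c" for a c
  assume "S \<noteq> ?T"
  have T: "?T = (\<lambda>j. complex_of_real r * S0_root k n j) ` {..<k}" by (simp add: S\<^sub>0_eq image_image)
  have "card S = k" using bij_betw_same_card[OF e(1)] by simp
  moreover have "card ?T \<le> k" unfolding T using card_image_le[of "{..<k}"] by simp
  ultimately have "\<not> S \<subseteq> ?T" using card_seteq[of ?T S] \<open>S \<noteq> ?T\<close> unfolding T by auto
  then obtain i where i: "i < k" "e i \<notin> ?T" using e(1) by (auto simp: bij_betw_def)
  have orth: "(\<Sum>c<n. F i c * G j c) = 0" if j: "j < k" for j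
  proof -
    \<comment> \<open>Chosen so that \<open>inverse z\<close> is the base of row \<open>j\<close> of
      \<open>G\<close>.\<close>
    define z where "z = complex_of_real r * S0_root k n (k - 1 - j)"
    have "k - 1 - j < k" using j by simp
    then have z: "z \<in> ?T" "z ^ n = of_real (r ^ n) * (-1) powi (int k - 1)" "z \<noteq> 0"
      using r S0_root_power[OF n, of "k - 1 - j" k] unfolding T z_def
      by (auto simp: power_mult_distrib S0_root_def)
    have "inverse z = complex_of_real (1 / r) * S0_root k n j"
      using inverse_S0_root[of "k - 1 - j" k n] j by (simp add: z_def inverse_mult_distrib divide_inverse)
    then have "(\<Sum>c<n. F i c * G j c) = (\<Sum>c<n. e i ^ c * inverse z ^ c)"
      by (simp only: F_def G_def)
    also have "\<dots> = 0" using sum_ratio_powers[of "e i" n z] z e(2)[OF i(1)] i(2) by auto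
    finally show ?thesis .
  qed
  \<comment> \<open>Absorbs the scalars of both families of minors, so that every term of the
    Cauchy--Binet sum becomes nonnegative.\<close>
  define d' where "d' = d / sine_const k"
  let ?E = "{..<k} \<rightarrow>\<^sub>E {..<n}"
  have G: "\<exists>q > 0. col_det k G g = sine_const k * complex_of_real q"
    if "strict_mono_on {..<k} g" "g ` {..<k} \<subseteq> {..<n}" for g
  proof -
    have "0 < (1 / r) ^ (\<Sum>b<k. g b) *
        (\<Prod>b<k. \<Prod>l<b. sin ((real (g b) - real (g l)) / real n * pi))"
      using r by (intro mult_pos_pos sine_product_pos[OF that]) simp
    then show ?thesis unfolding G_def col_det_S0[OF n] by blast
  qed
  have nonneg: "d' * (col_det k F f * col_det k G f) \<in> \<real>\<^sub>\<ge>\<^sub>0" if "f \<in> ?E" for f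
  proof (rule col_det_product_nonneg)
    fix g assume g: "strict_mono_on {..<k} g" "g ` {..<k} \<subseteq> {..<n}"
    obtain q where q: "q > 0" "col_det k G g = sine_const k * complex_of_real q"
      using G[OF g] by blast
    have "d' * (col_det k F g * col_det k G g) = (d * col_det k F g) * complex_of_real q"
      using sine_const_nonzero[of k] by (simp add: d'_def q(2))
    moreover have "(d * col_det k F g) * complex_of_real q \<in> \<real>\<^sub>\<ge>\<^sub>0"
      unfolding F_def using q(1) by (intro nonneg_Reals_mult_I d(2)[OF g]) simp
    ultimately show "d' * (col_det k F g * col_det k G g) \<in> \<real>\<^sub>\<ge>\<^sub>0" by (simp only:)
  qed (use that in \<open>auto simp: PiE_def\<close>)
  have fin: "finite ?E" by (intro finite_PiE) auto
  define f where "f = restrict (\<lambda>b. b) {..<k}"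
  have f: "f \<in> ?E" using k by (auto simp: f_def)
  have eq: "col_det k H f = col_det k H (\<lambda>b. b)" for H
    by (rule col_det_cong) (simp add: f_def)
  \<comment> \<open>Nonnegative terms with sum zero all vanish, but the term of the first
    \<open>k\<close> columns does not.\<close>
  have "(\<Sum>f\<in>?E. Re (d' * (col_det k F f * col_det k G f)))
      = Re (d' * (\<Sum>f\<in>?E. col_det k F f * col_det k G f))"
    by (simp add: sum_distrib_left)
  also have "\<dots> = 0" using col_det_orthogonal[of i k F G n, OF i(1) orth] by simp
  finally have "Re (d' * (col_det k F f * col_det k G f)) = 0"
    using nonneg f by (subst (asm) sum_nonneg_eq_0_iff[OF fin]) (auto simp: complex_nonneg_Reals_iff)
  then have "d' * (col_det k F f * col_det k G f) = 0"
    using nonneg[OF f] by (simp add: complex_nonneg_Reals_iff complex_eq_iff)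
  moreover have "col_det k F f \<noteq> 0"
    unfolding eq F_def using e(1) by (intro col_det_powers_nonzero) (simp add: bij_betw_def)
  moreover have "col_det k G f \<noteq> 0"
  proof -
    have "strict_mono_on {..<k} (\<lambda>b. b)" by (rule strict_mono_onI)
    then show ?thesis using G[of "\<lambda>b. b"] k sine_const_nonzero[of k] unfolding eq by auto
  qed
  ultimately show False using d(1) sine_const_nonzero[of k] by (simp add: d'_def)
qed

section \<open>The sine formula and the assembled result\<close>

lemma powr_divide_root:
  assumes "0 < x" "1 \<le> n"
  shows "x powr (real m / real n) = root n x ^ m"
proof -
  have "root n x ^ m = (x powr (1 / real n)) powr real m"
    using assms by (simp add: root_powr_inverse powr_realpow[symmetric])
  then show ?thesis by (simp add: powr_powr)
qed

lemma plucker_coords_scaled_S\<^sub>0: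
  assumes n: "1 \<le> n" and x: "0 < x" and S: "S = (\<lambda>z. complex_of_real (root n x) * z) ` S\<^sub>0 k n"
    "card S = k" and Gr: "V_span n S \<in> Gr k n"
  shows "plucker_coords k n (V_span n S)
          (\<lambda>I. complex_of_real (x powr (real (\<Sum>I) / real n) *
            (\<Prod>(i, j) \<in> {(i, j). i \<in> I \<and> j \<in> I \<and> i < j}.
              sin ((real j - real i) / real n * pi))))"
proof -
  define r where "r = root n x"
  have r: "r > 0" using x n by (simp add: r_def)
  let ?e = "\<lambda>j. complex_of_real r * S0_root k n j"
  have T: "S = ?e ` {..<k}" by (simp add: S(1) S\<^sub>0_eq image_image r_def)
  \<comment> \<open>Distinctness of the \<open>k\<close> points follows from
    \<open>card S = k\<close>.\<close>
  have e: "bij_betw ?e {..<k} S"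
    using eq_card_imp_inj_on[of "{..<k}" ?e] S(2) T by (simp add: bij_betw_def)
  show ?thesis
  proof (rule plucker_coords_V_spanI[OF Gr e])
    \<comment> \<open>The factor \<open>r ^ k\<close> accounts for columns numbered from 1 in the
      exponent; the division removes the constant of the sine formula.\<close>
    show "of_real r ^ k / sine_const k \<noteq> 0" using r sine_const_nonzero[of k] by simp
    fix f assume f: "strict_mono_on {..<k} f" "f ` {..<k} \<subseteq> {..<n}"
    let ?h = "\<lambda>b. Suc (f b)"
    have h: "strict_mono_on {..<k} ?h" using f(1) by (auto simp: strict_mono_on_def)
    have "\<Sum>(?h ` {..<k}) = (\<Sum>b<k. f b) + k"
      using strict_mono_on_imp_inj_on[OF h] by (simp add: sum.reindex sum_Suc)
    then have p: "x powr (real (\<Sum>(?h ` {..<k})) / real n) = r ^ (\<Sum>b<k. f b) * r ^ k"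
      by (simp only: powr_divide_root[OF x n] r_def power_add)
    show "complex_of_real (x powr (real (\<Sum>(?h ` {..<k})) / real n) *
            (\<Prod>(i, j) \<in> {(i, j). i \<in> ?h ` {..<k} \<and> j \<in> ?h ` {..<k} \<and> i < j}.
              sin ((real j - real i) / real n * pi)))
      = of_real r ^ k / sine_const k * col_det k (\<lambda>a c. (of_real r * S0_root k n a) ^ c) f"
      unfolding p prod_pairs_strict_mono_image[OF h] col_det_S0[OF n]
      using sine_const_nonzero[of k] by simp
  qed
qed

text \<open>For \<open>k = 0\<close> and \<open>k = n\<close> the only point is totally nonnegative
  for every \<open>t\<close>, so there the equivalence is stated only for positive
  \<open>t\<close>.\<close>

theorem theorem3p3:
  fixes n k :: nat and t :: complex
  assumes "1 \<le> n" and "k \<le> n" and "t \<noteq> 0"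
  shows "card {V \<in> Gr k n. \<sigma> k n t ` V = V} = n choose k \<and>
    {V \<in> Gr k n. \<sigma> k n t ` V = V} = V_span n ` root_subsets k n t \<and>
    (\<forall>S \<in> root_subsets k n t.
      (0 < k \<and> k < n \<or> pos_real t \<longrightarrow>
        (totally_nonneg k n (V_span n S) \<longleftrightarrow>
          pos_real t \<and> S = (\<lambda>z. complex_of_real (root n (Re t)) * z) ` S\<^sub>0 k n)) \<and>
      (pos_real t \<and> S = (\<lambda>z. complex_of_real (root n (Re t)) * z) ` S\<^sub>0 k n \<longrightarrow>
        plucker_coords k n (V_span n S)
          (\<lambda>I. complex_of_real (Re t powr (real (\<Sum>I) / real n) *
            (\<Prod>(i, j) \<in> {(i, j). i \<in> I \<and> j \<in> I \<and> i < j}.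
              sin ((real j - real i) / real n * pi))))))"
proof (intro conjI ballI impI)
  have root_vectors: "root_vectors n (twist k t)"
    using assms twist_nonzero by unfold_locales auto
  show "card {V \<in> Gr k n. \<sigma> k n t ` V = V} = n choose k"
    by (rule root_vectors.card_fixed_points[OF root_vectors refl])
  show fixed: "{V \<in> Gr k n. \<sigma> k n t ` V = V} = V_span n ` root_subsets k n t"
    by (rule root_vectors.fixed_points_eq[OF root_vectors refl])
  fix S assume S: "S \<in> root_subsets k n t"
  let ?T = "(\<lambda>z. complex_of_real (root n (Re t)) * z) ` S\<^sub>0 k n"
  let ?p = "\<lambda>I. complex_of_real (Re t powr (real (\<Sum>I) / real n) *
            (\<Prod>(i, j) \<in> {(i, j). i \<in> I \<and> j \<in> I \<and> i < j}. sin ((real j - real i) / real n * pi)))"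
  have Gr: "V_span n S \<in> Gr k n" using fixed S by blast
  show plucker: "plucker_coords k n (V_span n S) ?p" if "pos_real t \<and> S = ?T"
    using that assms(1) Gr S by (intro plucker_coords_scaled_S\<^sub>0) (auto simp: pos_real_def root_subsets_def)
  obtain e where e: "bij_betw e {..<k} S" "\<And>a. a < k \<Longrightarrow> e a ^ n = twist k t"
    "\<And>a. a < k \<Longrightarrow> e a \<noteq> 0"
    using root_subset_enum[OF assms(1,3) S] by blast
  assume hyp: "0 < k \<and> k < n \<or> pos_real t"
  show "totally_nonneg k n (V_span n S) \<longleftrightarrow> pos_real t \<and> S = ?T"
  proof
    assume "totally_nonneg k n (V_span n S)"
    then obtain d where d: "d \<noteq> 0" "\<And>f. strict_mono_on {..<k} f \<Longrightarrow> f ` {..<k} \<subseteq> {..<n} \<Longrightarrow>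
        d * col_det k (\<lambda>a c. e a ^ c) f \<in> \<real>\<^sub>\<ge>\<^sub>0"
      using totally_nonneg_V_spanD[OF _ e(1) assms(2)] by blast
    have "inj_on e {..<k}" using e(1) by (simp add: bij_betw_def)
    then have pos: "pos_real t"
      using hyp totally_nonneg_imp_pos_real[OF _ _ assms(3) _ e(2,3) d] by blast
    then have t: "t = of_real (root n (Re t) ^ n)" "0 < root n (Re t)"
      using assms(1) by (auto simp: pos_real_def complex_eq_iff complex_is_Real_iff)
    then have "e a ^ n = of_real (root n (Re t) ^ n) * (-1) powi (int k - 1)" if "a < k" for a
      using e(2)[OF that] by (simp add: twist_def)
    then show "pos_real t \<and> S = ?T"
      using pos totally_nonneg_imp_eq_scaled_S\<^sub>0[OF assms(1,2) t(2) e(1) _ d] by blast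
  next
    assume T: "pos_real t \<and> S = ?T"
    have "?p I \<in> \<real>\<^sub>\<ge>\<^sub>0" if I: "I \<in> k_subsets k n" for I
    proof -
      obtain f where f: "strict_mono_on {..<k} f" "f ` {..<k} \<subseteq> {..<n}" "I = (\<lambda>b. Suc (f b)) ` {..<k}"
        using I by (auto simp: k_subsets_iff)
      have h: "strict_mono_on {..<k} (\<lambda>b. Suc (f b))" using f(1) by (auto simp: strict_mono_on_def)
      show ?thesis
        unfolding f(3) prod_pairs_strict_mono_image[OF h] nonneg_Reals_of_real_iff
        using sine_product_pos[OF f(1,2)] by (intro mult_nonneg_nonneg) auto
    qed
    then show "totally_nonneg k n (V_span n S)"
      using plucker[OF T] unfolding totally_nonneg_def by (intro exI[of _ ?p]) blast
  qed
qed

end
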